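(* The following hold. (i) For every real $a>1$, with $A=A[a,1,1]$, we have $\mathbb V_1[A]=\mathbb V_1\cap\mathbb T[A]=\Phi(1)'$. (ii) For every real $b>0$ with $b\ne1$ and every real $a>2$, with $A=A[a,b,\frac1b]$, we have $\mathbb V_1[A]=\mathbb V_1\cap\mathbb T[A]$. (iii) For all reals $b>1$ and $c>1$, with $A=A[1,b,c]$, we have $\mathbb V_1[A]=\mathbb V_1\cap\mathbb T[A]$.
   Context: $M_n$ is the algebra of complex $n\times n$ matrices, with matrix units $e_{ij}$. Everything takes place in $M_3\otimes M_3$, identified with $9\times 9$ matrices using the lexicographically ordered basis $e_i\otimes e_j$ of $\mathbb C^3\otimes\mathbb C^3$. $\mathbb V_1$ is the convex cone generated by the separable states, i.e. all finite sums of matrices $zz^*$ with $z=x\otimes y$ a product vector in $\mathbb C^3\otimes\mathbb C^3$. For $A=\sum e_{ij}\otimes x_{ij}$ the partial transpose is $A^\Gamma=\sum e_{ij}\otimes x_{ji}$. $\mathbb T$ is the convex cone of all positive semi-definite $A$ with $A^\Gamma$ positive semi-definite; $\mathbb V_1\subset\mathbb T$. A convex subset $F$ of a convex set $C$ is a face of $C$ if $x,y\in C$ and $(1-t)x+ty\in F$ for some $t\in(0,1)$ imply $x,y\in F$. For $A\in\mathbb V_1$, $\mathbb V_1[A]$ is the smallest face of $\mathbb V_1$ containing $A$. With $\mathcal R$ denoting range, $\mathbb T[A]=\{B\in\mathbb T:\mathcal RB\subset\mathcal RA,\ \mathcal RB^\Gamma\subset\mathcal RA^\Gamma\}$, which is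 the smallest face of $\mathbb T$ containing $A$. For nonnegative reals $a,b,c$, $A[a,b,c]$ is the $9\times9$ matrix with diagonal $(a,c,b,b,a,c,c,b,a)$, with entry $1$ at the positions $(i,j)$ for $i\ne j$ in $\{1,5,9\}$, and all other entries $0$. (All matrices $A$ in the claim are separable.) $\Phi(1):M_3\to M_3$ is the positive linear map $$\Phi(1)(X)=\begin{pmatrix}x_{22}+x_{33}&-x_{12}&-x_{13}\\-x_{21}&x_{11}+x_{33}&-x_{23}\\-x_{31}&-x_{32}&x_{11}+x_{22}\end{pmatrix}.$$ For a linear map $\phi:M_3\to M_3$ and $A\in M_3\otimes M_3$, $\langle A,\phi\rangle=\mathrm{Tr}(C_\phi A^{\mathrm t})$ with $C_\phi=\sum_{i,j}e_{ij}\otimes\phi(e_{ij})$ and $A^{\mathrm t}$ the full transpose. For a positive linear map $\phi$, its dual face is $\phi'=\{A\in\mathbb V_1:\langle A,\phi\rangle=0\}$. *)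

theory Defs
  imports "HOL-Analysis.Analysis"
begin

text \<open>
  A matrix in the tensor square of \<open>M3\<close> has rows and columns indexed by pairs; the index
  \<open>(i, k)\<close> stands for the basis vector \<open>e_i \<otimes> e_k\<close>. In the lexicographic order the
  positions 1, ..., 9 are therefore (1,1), (1,2), (1,3), (2,1), ..., (3,3).
\<close>

type_synonym M3 = "complex ^ 3 ^ 3"
type_synonym M33 = "complex ^ (3 \<times> 3) ^ (3 \<times> 3)"

definition munit :: "3 \<Rightarrow> 3 \<Rightarrow> M3" where
  "munit i j = (\<chi> k l. if k = i \<and> l = j then 1 else 0)"

definition kron :: "M3 \<Rightarrow> M3 \<Rightarrow> M33" where
  "kron X Y = (\<chi> p q. X $ fst p $ fst q * Y $ snd p $ snd q)"

definition block :: "M33 \<Rightarrow> 3 \<Rightarrow> 3 \<Rightarrow> M3" where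
  "block A i j = (\<chi> k l. A $ (i, k) $ (j, l))"

lemma kron_munit_sum_nth:
  "(\<Sum>i\<in>UNIV. \<Sum>j\<in>UNIV. kron (munit i j) (B i j)) $ (i', k) $ (j', l) = B i' j' $ k $ l"
proof -
  have "(\<Sum>i\<in>UNIV. \<Sum>j\<in>UNIV. kron (munit i j) (B i j)) $ (i', k) $ (j', l)
      = (\<Sum>i\<in>UNIV. \<Sum>j\<in>UNIV. if i = i' then if j = j' then B i j $ k $ l else 0 else 0)"
    by (auto simp: kron_def munit_def intro!: sum.cong)
  also have "\<dots> = B i' j' $ k $ l"
    by (simp add: sum.swap[of _ UNIV UNIV])
  finally show ?thesis .
qed

lemma block_decomposition: "A = (\<Sum>i\<in>UNIV. \<Sum>j\<in>UNIV. kron (munit i j) (block A i j))"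
  using kron_munit_sum_nth[of "block A"]
  by (simp add: vec_eq_iff) (simp add: block_def)

definition partial_transpose :: "M33 \<Rightarrow> M33" where
  "partial_transpose A = (\<Sum>i\<in>UNIV. \<Sum>j\<in>UNIV. kron (munit i j) (block A j i))"

lemma partial_transpose_nth: "partial_transpose A $ (i, k) $ (j, l) = A $ (j, k) $ (i, l)"
  using kron_munit_sum_nth[of "\<lambda>i j. block A j i"]
  by (simp add: partial_transpose_def) (simp add: block_def)

text \<open>Over the complex numbers, nonnegativity of the form already forces the matrix to be Hermitian.\<close>

definition psd :: "complex ^ 'n ^ 'n \<Rightarrow> bool" where
  "psd A \<longleftrightarrow> (\<forall>z. (\<Sum>i\<in>UNIV. \<Sum>j\<in>UNIV. cnj (z $ i) * A $ i $ j * z $ j) \<in> \<real>\<^sub>\<ge>\<^sub>0)"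

definition mrange :: "complex ^ 'n ^ 'n \<Rightarrow> (complex ^ 'n) set" where
  "mrange A = range (\<lambda>z. A *v z)"

definition prod_vec :: "complex ^ 3 \<Rightarrow> complex ^ 3 \<Rightarrow> complex ^ (3 \<times> 3)" where
  "prod_vec x y = (\<chi> p. x $ fst p * y $ snd p)"

definition outer :: "complex ^ 'n \<Rightarrow> complex ^ 'n ^ 'n" where
  "outer z = (\<chi> i j. z $ i * cnj (z $ j))"

definition V1 :: "M33 set" where
  "V1 = convex_cone hull {outer (prod_vec x y) | x y. True}"

lemma V1_eq_finite_sums:
  "V1 = {(\<Sum>k<n. outer (prod_vec (x k) (y k))) | (n::nat) x y. True}" (is "_ = ?S")
proof
  have scale: "c *\<^sub>R outer (prod_vec x y) = outer (prod_vec (sqrt c *\<^sub>R x) y)" if "c \<ge> 0" for c x y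
    using that by (simp add: outer_def prod_vec_def vec_eq_iff)
  have "{outer (prod_vec x y) | x y. True} \<subseteq> ?S"
  proof clarify
    fix x y
    show "\<exists>(n::nat) x' y'. outer (prod_vec x y) = (\<Sum>k<n. outer (prod_vec (x' k) (y' k))) \<and> True"
      by (intro exI[of _ 1] exI[of _ "\<lambda>_. x"] exI[of _ "\<lambda>_. y"]) simp
  qed
  moreover have "convex_cone ?S"
    unfolding convex_cone_iff
  proof (intro conjI ballI allI impI)
    show "0 \<in> ?S"
      by (auto intro!: exI[of _ 0])
  next
    fix A B assume "A \<in> ?S" "B \<in> ?S"
    then obtain n m :: nat and x y x' y' where
      A: "A = (\<Sum>k<n. outer (prod_vec (x k) (y k)))" and
      B: "B = (\<Sum>k<m. outer (prod_vec (x' k) (y' k)))"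
      by blast
    define X where "X k = (if k < n then x k else x' (k - n))" for k
    define Y where "Y k = (if k < n then y k else y' (k - n))" for k
    have "(\<Sum>k<n + m. outer (prod_vec (X k) (Y k)))
        = (\<Sum>k<n. outer (prod_vec (X k) (Y k))) + (\<Sum>k<m. outer (prod_vec (X (n + k)) (Y (n + k))))"
      by (induction m) (simp_all add: add.assoc)
    then have "A + B = (\<Sum>k<n + m. outer (prod_vec (X k) (Y k)))"
      by (simp add: A B X_def Y_def)
    then show "A + B \<in> ?S" by blast
  next
    fix A and c :: real assume "A \<in> ?S" "0 \<le> c"
    then obtain n :: nat and x y where "A = (\<Sum>k<n. outer (prod_vec (x k) (y k)))"
      by blast
    then have "c *\<^sub>R A = (\<Sum>k<n. outer (prod_vec (sqrt c *\<^sub>R x k) (y k)))"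
      using \<open>0 \<le> c\<close> by (simp add: scaleR_sum_right scale)
    then show "c *\<^sub>R A \<in> ?S"
      by (intro CollectI exI[of _ n] exI[of _ "\<lambda>k. sqrt c *\<^sub>R x k"] exI[of _ y]) simp
  qed
  ultimately show "V1 \<subseteq> ?S"
    unfolding V1_def by (rule hull_minimal)
  have "(\<Sum>k<n. outer (prod_vec (x k) (y k))) \<in> V1" for n :: nat and x y
  proof (induction n)
    case 0
    show ?case by (simp add: V1_def convex_cone_hull_contains_0)
  next
    case (Suc n)
    have "outer (prod_vec (x n) (y n)) \<in> V1"
      unfolding V1_def by (rule hull_inc) blast
    with Suc show ?case
      unfolding V1_def by (simp add: convex_cone_hull_add)
  qed
  then show "?S \<subseteq> V1" by blast
qed

definition V1_face :: "M33 \<Rightarrow> M33 set" where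
  "V1_face A = \<Inter> {F. F face_of V1 \<and> A \<in> F}"

lemma V1_face_smallest:
  assumes "A \<in> V1"
  shows "V1_face A face_of V1" "A \<in> V1_face A"
    and "F face_of V1 \<Longrightarrow> A \<in> F \<Longrightarrow> V1_face A \<subseteq> F"
proof -
  have "V1 face_of V1"
    by (simp add: V1_def convex_convex_cone_hull face_of_refl)
  then show "V1_face A face_of V1"
    unfolding V1_face_def using assms by (intro face_of_Inter) auto
qed (auto simp: V1_face_def)

definition PPT :: "M33 set" where
  "PPT = {A. psd A \<and> psd (partial_transpose A)}"

definition PPT_face :: "M33 \<Rightarrow> M33 set" where
  "PPT_face A = {B \<in> PPT. mrange B \<subseteq> mrange A \<and>
     mrange (partial_transpose B) \<subseteq> mrange (partial_transpose A)}"

text \<open>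
  The 3 by 3 table lists the diagonal (a,c,b,b,a,c,c,b,a) in lexicographic order;
  the positions 1, 5, 9 are the indices \<open>(i, i)\<close>.
\<close>

definition Amat :: "real \<Rightarrow> real \<Rightarrow> real \<Rightarrow> M33" where
  "Amat a b c = (\<chi> p q.
     if p = q then
       of_real ((vector [vector [a, c, b], vector [b, a, c], vector [c, b, a]] :: real ^ 3 ^ 3)
                  $ fst p $ snd p)
     else if fst p = snd p \<and> fst q = snd q then 1 else 0)"

lemma Amat_diagonal_lex:
  "map (\<lambda>p. Amat a b c $ p $ p) [(1,1), (1,2), (1,3), (2,1), (2,2), (2,3), (3,1), (3,2), (3,3)] =
   map of_real [a, c, b, b, a, c, c, b, a]"
  by (simp add: Amat_def vector_3)

definition Phi1 :: "M3 \<Rightarrow> M3" where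
  "Phi1 X = vector
     [vector [X $ 2 $ 2 + X $ 3 $ 3, - X $ 1 $ 2, - X $ 1 $ 3],
      vector [- X $ 2 $ 1, X $ 1 $ 1 + X $ 3 $ 3, - X $ 2 $ 3],
      vector [- X $ 3 $ 1, - X $ 3 $ 2, X $ 1 $ 1 + X $ 2 $ 2]]"

definition Choi :: "(M3 \<Rightarrow> M3) \<Rightarrow> M33" where
  "Choi \<phi> = (\<Sum>i\<in>UNIV. \<Sum>j\<in>UNIV. kron (munit i j) (\<phi> (munit i j)))"

definition pairing :: "M33 \<Rightarrow> (M3 \<Rightarrow> M3) \<Rightarrow> complex" where
  "pairing A \<phi> = trace (Choi \<phi> ** transpose A)"

definition dual_face :: "(M3 \<Rightarrow> M3) \<Rightarrow> M33 set" where
  "dual_face \<phi> = {A \<in> V1. pairing A \<phi> = 0}"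

end

theory Submission
  imports Defs
begin

text \<open>
  For these \<open>A\<close> the ranges of \<open>A\<close> and of its partial transpose are cut out by equations
  \<open>w_p = \<beta> w_q\<close>, so membership of a separable \<open>B\<close> in \<open>T[A]\<close> says that a linear
  functional, nonnegative on \<open>V1\<close>, vanishes at \<open>B\<close>; in case (i) this functional is the pairing
  with \<open>\<Phi>(1)\<close>. Hence \<open>V1 \<inter> T[A]\<close> is a face, and it is the smallest one containing \<open>A\<close> once
  \<open>A - \<epsilon> zz\<^sup>*\<close> is separable with some \<open>\<epsilon> > 0\<close> for every product vector \<open>z = x \<otimes> y\<close> satisfying the
  equations. Averaging \<open>zz\<^sup>*\<close> over diagonal unitaries \<open>g \<otimes> g\<^sup>*\<close> taken from a group of order 7,
  which contains the identity, kills all entries outside the pattern of \<open>A\<close>. So it is enough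
  to subtract \<open>\<epsilon>\<close> times the average, and the difference is again a sum of such averages and a
  nonnegative diagonal matrix.
\<close>

section \<open>Faces cut out by range equations\<close>

text \<open>The empty set of equations gives the whole space, so matrices of full rank fit the same
  scheme.\<close>

definition eqs :: "('n \<times> 'n \<times> real) set \<Rightarrow> (complex ^ 'n) set" where
  "eqs E = {w. \<forall>(p, q, \<beta>) \<in> E. w $ p = of_real \<beta> * w $ q}"

text \<open>Each summand is the quadratic form of \<open>M\<close> at the vector e_p - \<beta> e_q;
  on \<open>outer w\<close> it is the squared modulus of w_p - \<beta> w_q.\<close>

definition defect :: "('n \<times> 'n \<times> real) set \<Rightarrow> complex ^ 'n ^ 'n \<Rightarrow> complex" where
  "defect E M = (\<Sum>(p, q, \<beta>) \<in> E. M $ p $ p - of_real \<beta> * M $ p $ q - of_real \<beta> * M $ q $ p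
     + of_real (\<beta>\<^sup>2) * M $ q $ q)"

lemma defect_add: "defect E (M + N) = defect E M + defect E N"
  unfolding defect_def sum.distrib [symmetric]
  by (intro sum.cong) (auto simp: algebra_simps)

lemma defect_scaleR: "defect E (c *\<^sub>R M) = of_real c * defect E M"
  unfolding defect_def sum_distrib_left
  by (intro sum.cong) (auto simp: algebra_simps scaleR_conv_of_real[where 'a=complex])

lemma defect_0: "defect E 0 = 0"
  by (auto simp: defect_def intro!: sum.neutral)

lemma defect_sum: "defect E (\<Sum>k\<in>K. M k) = (\<Sum>k\<in>K. defect E (M k))"
  by (induction K rule: infinite_finite_induct) (auto simp: defect_add defect_0)

lemma defect_outer:
  "defect E (outer w) = of_real (\<Sum>(p, q, \<beta>) \<in> E. (cmod (w $ p - of_real \<beta> * w $ q))\<^sup>2)"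
  unfolding defect_def of_real_sum
  by (intro sum.cong)
     (auto simp only: case_prod_conv split: prod.split, simp only: complex_norm_square,
       simp add: outer_def algebra_simps power2_eq_square)

lemma defect_outer_eq_0_iff:
  assumes "finite E"
  shows "defect E (outer w) = 0 \<longleftrightarrow> w \<in> eqs E"
  unfolding defect_outer of_real_eq_0_iff using assms
  by (subst sum_nonneg_eq_0_iff) (auto simp: eqs_def)

text \<open>Every column of \<open>M\<close> satisfies the equations, and the summand is (M_pp -
  \<beta> M_qp) - \<beta> (M_pq - \<beta> M_qq).\<close>

lemma defect_eq_0_if_mrange_subset:
  assumes "mrange M \<subseteq> eqs E"
  shows "defect E M = 0"
  unfolding defect_def
proof (intro sum.neutral ballI, clarify)
  fix p q \<beta> assume E: "(p, q, \<beta>) \<in> E"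
  have "M $ p $ r = of_real \<beta> * M $ q $ r" for r
  proof -
    have "M *v axis r 1 \<in> eqs E"
      using assms by (auto simp: mrange_def)
    then have "(M *v axis r 1) $ p = of_real \<beta> * (M *v axis r 1) $ q"
      using E by (auto simp: eqs_def)
    then show ?thesis
      by (simp add: matrix_vector_mult_def axis_def if_distrib cong: if_cong)
  qed
  then show "M $ p $ p - of_real \<beta> * M $ p $ q - of_real \<beta> * M $ q $ p
     + of_real (\<beta>\<^sup>2) * M $ q $ q = 0"
    by (simp add: power2_eq_square)
qed

lemma mrange_sum_outer_subset:
  assumes "\<And>k. k \<in> K \<Longrightarrow> w k \<in> eqs E"
  shows "mrange (\<Sum>k\<in>K. outer (w k)) \<subseteq> eqs E"
proof -
  have "(\<Sum>k\<in>K. outer (w k)) *v v \<in> eqs E" for v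
    using assms
    by (fastforce simp: eqs_def outer_def matrix_vector_mult_def sum_distrib_left sum_distrib_right
        algebra_simps intro!: sum.cong)
  then show ?thesis by (auto simp: mrange_def)
qed

text \<open>The form at \<open>z\<close> is the sum of the squared moduli of the inner products of
  \<open>z\<close> with the \<open>w k\<close>.\<close>

lemma psd_sum_outer: "psd (\<Sum>k\<in>K. outer (w k))"
  unfolding psd_def
proof
  fix z
  have "(\<Sum>i\<in>UNIV. \<Sum>j\<in>UNIV. cnj (z $ i) * (\<Sum>k\<in>K. outer (w k)) $ i $ j * z $ j)
      = (\<Sum>i\<in>UNIV. \<Sum>j\<in>UNIV. \<Sum>k\<in>K. cnj (z $ i) * (w k $ i * cnj (w k $ j)) * z $ j)"
    by (simp add: outer_def sum_distrib_left sum_distrib_right)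
  also have "\<dots> = (\<Sum>k\<in>K. \<Sum>i\<in>UNIV. \<Sum>j\<in>UNIV. cnj (z $ i) * (w k $ i * cnj (w k $ j)) * z $ j)"
    by (subst (2) sum.swap, subst sum.swap, rule refl)
  also have "\<dots> = (\<Sum>k\<in>K. (\<Sum>i\<in>UNIV. cnj (z $ i) * w k $ i) * cnj (\<Sum>i\<in>UNIV. cnj (z $ i) * w k $ i))"
    by (simp add: sum_product mult.assoc) (simp add: mult_ac)
  also have "\<dots> = of_real (\<Sum>k\<in>K. (cmod (\<Sum>i\<in>UNIV. cnj (z $ i) * w k $ i))\<^sup>2)"
    by (simp only: complex_norm_square of_real_sum)
  also have "\<dots> \<in> \<real>\<^sub>\<ge>\<^sub>0"
    by (simp only: nonneg_Reals_of_real_iff) (simp add: sum_nonneg)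
  finally show "(\<Sum>i\<in>UNIV. \<Sum>j\<in>UNIV. cnj (z $ i) * (\<Sum>k\<in>K. outer (w k)) $ i $ j * z $ j) \<in> \<real>\<^sub>\<ge>\<^sub>0" .
qed

definition cnj_vec :: "complex ^ 'n \<Rightarrow> complex ^ 'n" where
  "cnj_vec x = (\<chi> i. cnj (x $ i))"

text \<open>Transposing \<open>outer x\<close> conjugates \<open>x\<close>, and the partial
  transpose acts on the first tensor factor only.\<close>

lemma partial_transpose_sum_outer:
  "partial_transpose (\<Sum>k\<in>K. outer (prod_vec (x k) (y k)))
     = (\<Sum>k\<in>K. outer (prod_vec (cnj_vec (x k)) (y k)))"
  by (auto simp: vec_eq_iff partial_transpose_nth outer_def prod_vec_def cnj_vec_def mult_ac
      intro!: sum.cong)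

lemma partial_transpose_linear: "linear partial_transpose"
  by (rule linearI) (auto simp: vec_eq_iff partial_transpose_nth)

section \<open>The cone of separable matrices and its faces\<close>

lemma V1_cases:
  assumes "B \<in> V1"
  obtains n :: nat and x y where "B = (\<Sum>k<n. outer (prod_vec (x k) (y k)))"
  using assms by (auto simp: V1_eq_finite_sums)

lemma V1_outer: "outer (prod_vec x y) \<in> V1"
  unfolding V1_def by (rule hull_inc) blast

lemma V1_add: "A \<in> V1 \<Longrightarrow> B \<in> V1 \<Longrightarrow> A + B \<in> V1"
  unfolding V1_def by (rule convex_cone_hull_add)

lemma V1_scaleR: "A \<in> V1 \<Longrightarrow> 0 \<le> c \<Longrightarrow> c *\<^sub>R A \<in> V1"
  unfolding V1_def by (rule convex_cone_hull_mul)

lemma V1_0: "0 \<in> V1"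
  unfolding V1_def by (rule convex_cone_hull_contains_0)

lemma V1_sum: "(\<And>k. k \<in> K \<Longrightarrow> f k \<in> V1) \<Longrightarrow> (\<Sum>k\<in>K. f k) \<in> V1"
  by (induction K rule: infinite_finite_induct) (auto simp: V1_0 V1_add)

lemma convex_V1: "convex V1"
  unfolding V1_def by (rule convex_convex_cone_hull)

text \<open>Once a positive multiple of \<open>B\<close> can be subtracted from \<open>A\<close>
  within the cone, \<open>A\<close> is a proper convex combination of \<open>B\<close> and a second
  point \<open>D\<close> of the cone.\<close>

lemma face_of_V1_mem:
  assumes F: "F face_of V1" "A \<in> F" and B: "B \<in> V1" and \<epsilon>: "\<epsilon> > 0" "A - \<epsilon> *\<^sub>R B \<in> V1"
  shows "B \<in> F"
proof -
  \<comment> \<open>\<open>\<epsilon>\<close> may be 1 or more, while a convex weight must stay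
    below 1. Subtracting less of \<open>B\<close> remains possible, since \<open>A\<close> itself is
    in the cone.\<close>
  define \<delta> where "\<delta> = \<epsilon> / (1 + \<epsilon>)"
  have \<delta>: "0 < \<delta>" "\<delta> < 1" using \<epsilon> by (auto simp: \<delta>_def)
  have AV: "A \<in> V1" using F face_of_imp_subset by blast
  define D where "D = (1 / (1 - \<delta>)) *\<^sub>R (A - \<delta> *\<^sub>R B)"
  have "A - \<delta> *\<^sub>R B = (1 / (1 + \<epsilon>)) *\<^sub>R (A - \<epsilon> *\<^sub>R B) + \<delta> *\<^sub>R A"
  proof -
    have "A = (1 / (1 + \<epsilon>)) *\<^sub>R A + \<delta> *\<^sub>R A"
      using \<epsilon> by (simp add: \<delta>_def flip: scaleR_add_left add_divide_distrib)
    moreover have "(1 / (1 + \<epsilon>)) *\<^sub>R (A - \<epsilon> *\<^sub>R B) = (1 / (1 + \<epsilon>)) *\<^sub>R A - \<delta> *\<^sub>R B"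
      by (simp add: \<delta>_def scaleR_diff_right)
    ultimately show ?thesis by simp
  qed
  then have "D \<in> V1"
    unfolding D_def using \<epsilon> \<delta> AV by (auto intro!: V1_scaleR V1_add)
  have A: "A = \<delta> *\<^sub>R B + (1 - \<delta>) *\<^sub>R D"
    using \<delta> by (simp add: D_def)
  \<comment> \<open>An open segment with equal endpoints is empty, so the degenerate case is treated
    apart.\<close>
  show ?thesis
  proof (cases "B = D")
    case True
    then have "A = B" using A by (simp flip: scaleR_add_left)
    then show ?thesis using F by simp
  next
    case False
    then have "A \<in> open_segment B D"
      using A \<delta> by (auto simp: in_segment intro!: exI[of _ "1 - \<delta>"])
    then show ?thesis
      using F B \<open>D \<in> V1\<close> by (auto simp: face_of_def)
  qed
qed

text \<open>The weights \<open>?l\<close> and \<open>?m\<close> of the convex combination are chosen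
  so that \<open>B1\<close> and \<open>B2\<close> get the same coefficient.\<close>

lemma V1_absorb_add:
  assumes "\<epsilon>1 > 0" "A - \<epsilon>1 *\<^sub>R B1 \<in> V1" "\<epsilon>2 > 0" "A - \<epsilon>2 *\<^sub>R B2 \<in> V1"
  shows "\<exists>\<epsilon>>0. A - \<epsilon> *\<^sub>R (B1 + B2) \<in> V1"
proof (intro exI conjI)
  let ?l = "\<epsilon>2 / (\<epsilon>1 + \<epsilon>2)" and ?m = "\<epsilon>1 / (\<epsilon>1 + \<epsilon>2)"
  have "?l + ?m = 1" using assms by (simp flip: add_divide_distrib)
  then have "?l *\<^sub>R A + ?m *\<^sub>R A = A" by (simp flip: scaleR_add_left)
  then have "A - (\<epsilon>1 * \<epsilon>2 / (\<epsilon>1 + \<epsilon>2)) *\<^sub>R (B1 + B2) = ?l *\<^sub>R (A - \<epsilon>1 *\<^sub>R B1) + ?m *\<^sub>R (A - \<epsilon>2 *\<^sub>R B2)"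
    by (simp add: algebra_simps)
  then show "A - (\<epsilon>1 * \<epsilon>2 / (\<epsilon>1 + \<epsilon>2)) *\<^sub>R (B1 + B2) \<in> V1"
    using assms by (auto intro!: V1_add V1_scaleR)
qed (use assms in simp)

lemma V1_absorb_sum:
  assumes "A \<in> V1" "finite K" "\<And>k. k \<in> K \<Longrightarrow> \<exists>\<epsilon>>0. A - \<epsilon> *\<^sub>R f k \<in> V1"
  shows "\<exists>\<epsilon>>0. A - \<epsilon> *\<^sub>R (\<Sum>k\<in>K. f k) \<in> V1"
  using assms(2,3)
proof (induction K rule: finite_induct)
  case empty
  then show ?case using \<open>A \<in> V1\<close> by (auto intro!: exI[of _ 1])
next
  case (insert k K)
  then obtain \<epsilon>1 \<epsilon>2 where "\<epsilon>1 > 0" "A - \<epsilon>1 *\<^sub>R f k \<in> V1" "\<epsilon>2 > 0" "A - \<epsilon>2 *\<^sub>R (\<Sum>k\<in>K. f k) \<in> V1"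
    by (metis insertI1 insertI2)
  then show ?case using V1_absorb_add insert by simp
qed

text \<open>
  The total defect is linear and nonnegative on \<open>V1\<close>, so its zero set is a face; the
  absorption hypothesis says that \<open>A\<close> is a relative interior point of that face.
\<close>

lemma V1_face_eq_defect:
  fixes A :: M33
  assumes fin: "finite E" "finite E'"
    and range: "mrange A = eqs E" "mrange (partial_transpose A) = eqs E'"
    and absorb: "\<And>x y. prod_vec x y \<in> eqs E \<Longrightarrow> prod_vec (cnj_vec x) y \<in> eqs E'
        \<Longrightarrow> \<exists>\<epsilon>>0. A - \<epsilon> *\<^sub>R outer (prod_vec x y) \<in> V1"
  shows "V1_face A = V1 \<inter> PPT_face A"
    and "V1 \<inter> PPT_face A = {B \<in> V1. defect E B + defect E' (partial_transpose B) = 0}"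
proof -
  define Q where "Q B = defect E B + defect E' (partial_transpose B)" for B
  have Q_add: "Q (B + C) = Q B + Q C" and Q_scale: "Q (c *\<^sub>R B) = of_real c * Q B" for B C c
    by (simp_all add: Q_def defect_add defect_scaleR linear_add[OF partial_transpose_linear]
        linear_scale[OF partial_transpose_linear] algebra_simps)
  \<comment> \<open>\<open>q x y\<close> is the value of \<open>Q\<close> on the generator
    \<open>outer (prod_vec x y)\<close>.\<close>
  define q where "q x y = (\<Sum>(p, q, \<beta>) \<in> E. (cmod (prod_vec x y $ p - of_real \<beta> * prod_vec x y $ q))\<^sup>2)
     + (\<Sum>(p, q, \<beta>) \<in> E'. (cmod (prod_vec (cnj_vec x) y $ p - of_real \<beta> * prod_vec (cnj_vec x) y $ q))\<^sup>2)"
    for x y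
  have q_nonneg: "q x y \<ge> 0" for x y
    by (auto simp: q_def intro!: add_nonneg_nonneg sum_nonneg)
  have Q_sum: "Q (\<Sum>k<n. outer (prod_vec (x k) (y k))) = of_real (\<Sum>k<n. q (x k) (y k))"
    for n :: nat and x y
    by (simp add: Q_def partial_transpose_sum_outer defect_sum defect_outer q_def sum.distrib)
  have q_0: "prod_vec x y \<in> eqs E \<and> prod_vec (cnj_vec x) y \<in> eqs E'" if "q x y = 0" for x y
  proof -
    have nn: "(\<Sum>(p, q, \<beta>) \<in> D. (cmod (w $ p - of_real \<beta> * w $ q))\<^sup>2) \<ge> 0"
      for D :: "((3 \<times> 3) \<times> (3 \<times> 3) \<times> real) set" and w
      by (auto intro!: sum_nonneg)
    have "defect E (outer (prod_vec x y)) = 0" "defect E' (outer (prod_vec (cnj_vec x) y)) = 0"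
      using that nn[of "prod_vec x y" E] nn[of "prod_vec (cnj_vec x) y" E']
      unfolding q_def defect_outer by (auto simp only: of_real_eq_0_iff add_nonneg_eq_0_iff)
    then show ?thesis using fin by (simp add: defect_outer_eq_0_iff)
  qed
  have Q_nonneg: "Q B = of_real (Re (Q B)) \<and> Re (Q B) \<ge> 0" if "B \<in> V1" for B
    using that by (elim V1_cases) (simp add: Q_sum sum_nonneg q_nonneg)

  define H where "H = {B \<in> V1. Q B = 0}"
  \<comment> \<open>The zero vector satisfies all equations, so absorbing it, which subtracts
    nothing, shows that \<open>A\<close> is separable.\<close>
  obtain \<epsilon>0 where "\<epsilon>0 > 0" "A - \<epsilon>0 *\<^sub>R outer (prod_vec 0 0) \<in> V1"
    using absorb[of 0 0] by (auto simp: eqs_def prod_vec_def)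
  moreover have "outer (prod_vec 0 0) = 0"
    by (simp add: vec_eq_iff outer_def prod_vec_def)
  ultimately have AV: "A \<in> V1" by simp
  have V1_PPT: "B \<in> PPT" if "B \<in> V1" for B
    using that by (elim V1_cases) (simp add: PPT_def partial_transpose_sum_outer psd_sum_outer)

  have 1: "V1 \<inter> PPT_face A \<subseteq> H"
    using range by (auto simp: H_def Q_def PPT_face_def defect_eq_0_if_mrange_subset)
  \<comment> \<open>A vanishing sum of nonnegative terms has only zero terms, so every product
    vector in any decomposition satisfies the equations.\<close>
  have comp: "\<forall>k<n. prod_vec (x k) (y k) \<in> eqs E \<and> prod_vec (cnj_vec (x k)) (y k) \<in> eqs E'"
    if "Q (\<Sum>k<n. outer (prod_vec (x k) (y k))) = 0" for n :: nat and x y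
  proof -
    have "(\<Sum>k<n. q (x k) (y k)) = 0"
      using that by (simp only: Q_sum of_real_eq_0_iff)
    then have "\<forall>k<n. q (x k) (y k) = 0"
      by (subst (asm) sum_nonneg_eq_0_iff) (auto simp: q_nonneg)
    then show ?thesis using q_0 by blast
  qed
  have 2: "H \<subseteq> V1 \<inter> PPT_face A"
  proof
    fix B assume B: "B \<in> H"
    then have "B \<in> V1" by (simp add: H_def)
    then obtain n :: nat and x y where Bs: "B = (\<Sum>k<n. outer (prod_vec (x k) (y k)))"
      by (rule V1_cases)
    then have "\<forall>k<n. prod_vec (x k) (y k) \<in> eqs E \<and> prod_vec (cnj_vec (x k)) (y k) \<in> eqs E'"
      using B by (intro comp) (simp add: H_def)
    then have "mrange B \<subseteq> mrange A" "mrange (partial_transpose B) \<subseteq> mrange (partial_transpose A)"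
      unfolding range Bs partial_transpose_sum_outer by (auto intro!: mrange_sum_outer_subset)
    then show "B \<in> V1 \<inter> PPT_face A"
      using \<open>B \<in> V1\<close> V1_PPT by (simp add: PPT_face_def)
  qed
  have 3: "H \<subseteq> V1_face A"
  proof
    fix B assume B: "B \<in> H"
    then have BV: "B \<in> V1" by (simp add: H_def)
    then obtain n :: nat and x y where Bs: "B = (\<Sum>k<n. outer (prod_vec (x k) (y k)))"
      by (rule V1_cases)
    then have "\<forall>k<n. prod_vec (x k) (y k) \<in> eqs E \<and> prod_vec (cnj_vec (x k)) (y k) \<in> eqs E'"
      using B by (intro comp) (simp add: H_def)
    \<comment> \<open>\<open>A\<close> absorbs each summand of \<open>B\<close>, hence
      \<open>B\<close> itself, which puts \<open>B\<close> into every face containing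
      \<open>A\<close>.\<close>
    then have "\<exists>\<epsilon>>0. A - \<epsilon> *\<^sub>R B \<in> V1"
      unfolding Bs using AV by (intro V1_absorb_sum absorb) auto
    then show "B \<in> V1_face A"
      using face_of_V1_mem[OF V1_face_smallest(1,2)[OF AV] BV] by blast
  qed
  have "H face_of V1"
    unfolding face_of_def
  proof (intro conjI ballI impI)
    show "H \<subseteq> V1" by (auto simp: H_def)
    show "convex H"
      using convex_V1 by (auto simp: convex_def H_def Q_add Q_scale)
  next
    fix B C X assume B: "B \<in> V1" and C: "C \<in> V1" and X: "X \<in> H" "X \<in> open_segment B C"
    then obtain t where t: "0 < t" "t < 1" "X = (1 - t) *\<^sub>R B + t *\<^sub>R C"
      by (auto simp: in_segment)
    have "(1 - t) * Re (Q B) + t * Re (Q C) = Re (Q X)"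
      using t by (simp add: Q_add Q_scale)
    also have "\<dots> = 0" using X by (simp add: H_def)
    finally have "Re (Q B) = 0 \<and> Re (Q C) = 0"
      using t Q_nonneg[OF B] Q_nonneg[OF C] by (auto simp: add_nonneg_eq_0_iff)
    then have "Q B = 0 \<and> Q C = 0" using Q_nonneg[OF B] Q_nonneg[OF C] by (metis of_real_0)
    then show "B \<in> H" "C \<in> H"
      using B C by (auto simp: H_def)
  qed
  moreover have "A \<in> H"
    using 1 AV V1_PPT by (auto simp: PPT_face_def)
  ultimately have "V1_face A \<subseteq> H"
    using V1_face_smallest(3)[OF AV] by blast
  then show "V1_face A = V1 \<inter> PPT_face A"
    using 1 2 3 by blast
  show "V1 \<inter> PPT_face A = {B \<in> V1. defect E B + defect E' (partial_transpose B) = 0}"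
    using 1 2 by (auto simp: H_def Q_def)
qed

section \<open>Twirling\<close>

text \<open>Closed form of the average of \<open>outer (prod_vec x y)\<close> over the group of
  seven diagonal unitaries; \<open>sum_rot\<close> identifies the two.\<close>

definition twirl :: "complex ^ 3 \<Rightarrow> complex ^ 3 \<Rightarrow> M33" where
  "twirl x y = (\<chi> p q.
     if p = q then of_real ((cmod (x $ fst p))\<^sup>2 * (cmod (y $ snd p))\<^sup>2)
     else if fst p = snd p \<and> fst q = snd q
       then x $ fst p * y $ fst p * cnj (x $ fst q * y $ fst q) else 0)"

text \<open>Exponents of the diagonal unitary with entries 1, \<open>root7 ^ k\<close>,
  \<open>root7 ^ (3 * k)\<close>, which \<open>rot k\<close> applies; \<open>rot_inv k\<close>
  applies its inverse.\<close>

definition diff_set :: "nat ^ 3" where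
  "diff_set = vector [0, 1, 3]"

definition root7 :: complex where
  "root7 = cis (2 * pi / 7)"

definition rot :: "nat \<Rightarrow> complex ^ 3 \<Rightarrow> complex ^ 3" where
  "rot k x = (\<chi> i. root7 ^ (k * diff_set $ i) * x $ i)"

definition rot_inv :: "nat \<Rightarrow> complex ^ 3 \<Rightarrow> complex ^ 3" where
  "rot_inv k x = (\<chi> i. cnj root7 ^ (k * diff_set $ i) * x $ i)"

lemma root7_power_eq_1_iff: "root7 ^ m = 1 \<longleftrightarrow> 7 dvd m"
proof -
  have "root7 = exp (2 * of_real pi * \<i> / 7)"
    by (simp add: root7_def cis_conv_exp mult_ac)
  then have "root7 ^ m = exp (of_nat m * (2 * of_real pi * \<i> / 7))"
    by (simp only: exp_of_nat_mult)
  also have "of_nat m * (2 * of_real pi * \<i> / 7) = 2 * of_real pi * \<i> * of_nat m / of_nat 7"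
    by simp
  finally have "root7 ^ m = exp (2 * of_real pi * \<i> * of_nat m / of_nat 7)" .
  then show ?thesis
    using complex_root_unity_eq_1[of 7 m] by simp
qed

lemma root7_power_7: "root7 ^ 7 = 1"
  by (simp only: root7_power_eq_1_iff) simp

text \<open>On the unit circle conjugation is inversion. Writing it as a sixth power keeps all
  exponents natural numbers.\<close>

lemma cnj_root7: "cnj root7 = root7 ^ 6"
proof -
  have "cnj root7 * root7 = 1"
    by (simp add: root7_def cis_cnj cis_mult)
  moreover have "root7 * root7 ^ 6 = 1"
    using root7_power_7 by (simp add: power_numeral_reduce)
  ultimately show ?thesis
    by (metis mult.assoc mult.left_neutral mult.right_neutral)
qed

text \<open>Geometric sum of a seventh root of unity, which vanishes unless the root is 1.\<close>

lemma sum_root7: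
  "(\<Sum>k<7. root7 ^ (k * m)) = (if 7 dvd m then 7 else 0)"
proof -
  define \<zeta> where "\<zeta> = root7 ^ m"
  have "(\<Sum>k<7. root7 ^ (k * m)) = (\<Sum>k<7. \<zeta> ^ k)"
    by (simp add: \<zeta>_def mult.commute flip: power_mult)
  moreover have "\<zeta> ^ 7 = 1"
    by (simp only: \<zeta>_def root7_power_eq_1_iff flip: power_mult) simp
  then have "\<zeta> \<noteq> 1 \<Longrightarrow> (\<Sum>k<7. \<zeta> ^ k) = 0"
    by (simp add: geometric_sum)
  ultimately show ?thesis
    using root7_power_eq_1_iff[of m] by (auto simp: \<zeta>_def)
qed

text \<open>
  \<open>{0, 1, 3}\<close> is a perfect difference set modulo 7: the differences of two distinct
  elements are pairwise distinct and nonzero. The factor 6 stands for \<open>-1\<close>.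
\<close>

lemma diff_set_dvd_iff:
  "7 dvd diff_set $ i + 6 * diff_set $ j + 6 * diff_set $ k + diff_set $ l
     \<longleftrightarrow> (i = k \<and> j = l) \<or> (i = j \<and> k = l)"
proof -
  have "diff_set $ 1 = 0" "diff_set $ 2 = 1" "diff_set $ 3 = 3"
    by (simp_all add: diff_set_def)
  then have "\<forall>i j k l. 7 dvd diff_set $ i + 6 * diff_set $ j + 6 * diff_set $ k + diff_set $ l
     \<longleftrightarrow> (i = k \<and> j = l) \<or> (i = j \<and> k = l)"
    unfolding forall_3 by (simp del: One_nat_def)
  then show ?thesis by blast
qed

text \<open>Rotation multiplies each entry by a power of \<open>root7\<close>; the sum over
  \<open>k\<close> keeps just the entries whose exponent is 0 modulo 7, and by the difference set
  property these form the pattern of \<open>twirl\<close>.\<close>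

lemma sum_rot: "(\<Sum>k<7. outer (prod_vec (rot k x) (rot_inv k y))) = 7 *\<^sub>R twirl x y"
proof -
  have "(\<Sum>k<7. outer (prod_vec (rot k x) (rot_inv k y)) $ (i, j) $ (k', l))
      = 7 * twirl x y $ (i, j) $ (k', l)" for i j k' l
  proof -
    let ?m = "diff_set $ i + 6 * diff_set $ j + 6 * diff_set $ k' + diff_set $ l"
    have pow: "cnj root7 ^ e = root7 ^ (6 * e)" for e
      by (simp only: cnj_root7 power_mult)
    have "outer (prod_vec (rot k x) (rot_inv k y)) $ (i, j) $ (k', l)
        = x $ i * y $ j * cnj (x $ k' * y $ l) * root7 ^ (k * ?m)" for k
      by (simp add: outer_def prod_vec_def rot_def rot_inv_def)
         (simp add: pow power_add ring_distribs mult_ac)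
    then have "(\<Sum>k<7. outer (prod_vec (rot k x) (rot_inv k y)) $ (i, j) $ (k', l))
        = x $ i * y $ j * cnj (x $ k' * y $ l) * (\<Sum>k<7. root7 ^ (k * ?m))"
      by (simp only: sum_distrib_left)
    also have "\<dots> = 7 * twirl x y $ (i, j) $ (k', l)"
      unfolding sum_root7 diff_set_dvd_iff
      by (auto simp: twirl_def complex_norm_square mult_ac simp del: of_real_power)
    finally show ?thesis .
  qed
  then show ?thesis
    by (simp add: vec_eq_iff scaleR_conv_of_real)
qed

lemma twirl_in_V1: "twirl x y \<in> V1"
proof -
  have "twirl x y = (1 / 7) *\<^sub>R (\<Sum>k<7. outer (prod_vec (rot k x) (rot_inv k y)))"
    by (simp add: sum_rot)
  also have "\<dots> \<in> V1"
    by (auto intro!: V1_scaleR V1_sum V1_outer)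
  finally show ?thesis .
qed

text \<open>The term \<open>k = 0\<close> is the matrix of the given product vector, and the other
  six terms are separable.\<close>

lemma twirl_minus_outer_in_V1: "7 *\<^sub>R twirl x y - outer (prod_vec x y) \<in> V1"
proof -
  have "7 *\<^sub>R twirl x y
      = outer (prod_vec (rot 0 x) (rot_inv 0 y))
        + (\<Sum>k\<in>{..<7} - {0}. outer (prod_vec (rot k x) (rot_inv k y)))"
    unfolding sum_rot [symmetric] by (rule sum.remove) auto
  moreover have "rot 0 x = x" "rot_inv 0 y = y"
    by (simp_all add: rot_def rot_inv_def)
  ultimately have "7 *\<^sub>R twirl x y - outer (prod_vec x y)
      = (\<Sum>k\<in>{..<7} - {0}. outer (prod_vec (rot k x) (rot_inv k y)))"
    by simp
  then show ?thesis
    by (auto intro!: V1_sum V1_outer)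
qed

lemma absorb_outer_if_absorb_twirl:
  assumes "\<epsilon> > 0" "A - \<epsilon> *\<^sub>R twirl x y \<in> V1"
  shows "\<exists>\<epsilon>>0. A - \<epsilon> *\<^sub>R outer (prod_vec x y) \<in> V1"
proof (intro exI conjI)
  have "A - (\<epsilon> / 7) *\<^sub>R outer (prod_vec x y)
      = (A - \<epsilon> *\<^sub>R twirl x y) + (\<epsilon> / 7) *\<^sub>R (7 *\<^sub>R twirl x y - outer (prod_vec x y))"
    by (simp add: algebra_simps)
  also have "\<dots> \<in> V1"
    using assms by (intro V1_add V1_scaleR twirl_minus_outer_in_V1) auto
  finally show "A - (\<epsilon> / 7) *\<^sub>R outer (prod_vec x y) \<in> V1" .
qed (use assms in simp)

text \<open>Diagonal matrix units come from the product vectors e_i \<otimes> e_k, so nonnegative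
  diagonal matrices are separable.\<close>

lemma V1_add_diagonal:
  assumes X: "X \<in> V1" and off: "\<And>p q. p \<noteq> q \<Longrightarrow> M $ p $ q = X $ p $ q"
    and diag: "\<And>p. \<exists>d\<ge>0. M $ p $ p = X $ p $ p + of_real d"
  shows "M \<in> V1"
proof -
  obtain d where d: "\<And>p. d p \<ge> 0" "\<And>p. M $ p $ p = X $ p $ p + of_real (d p)"
    using diag by metis
  let ?e = "\<lambda>p. prod_vec (axis (fst p) 1) (axis (snd p) 1)"
  have e: "?e p $ r = (if p = r then 1 else 0)" for p r
    by (cases p; cases r) (auto simp: prod_vec_def axis_def)
  have "M = X + (\<Sum>p\<in>UNIV. d p *\<^sub>R outer (?e p))"
    unfolding vec_eq_iff
  proof (intro allI)
    fix r s
    have "(\<Sum>p\<in>UNIV. d p *\<^sub>R outer (?e p)) $ r $ s = (\<Sum>p\<in>UNIV. if p = r then if r = s then complex_of_real (d r) else 0 else 0)"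
      unfolding sum_component
      by (intro sum.cong) (auto simp: outer_def e scaleR_conv_of_real[where 'a = complex])
    also have "\<dots> = (if r = s then complex_of_real (d r) else 0)" by simp
    finally show "M $ r $ s = (X + (\<Sum>p\<in>UNIV. d p *\<^sub>R outer (?e p))) $ r $ s"
      using off d by auto
  qed
  then show ?thesis
    using d X by (auto intro!: V1_add V1_sum V1_scaleR V1_outer)
qed

section \<open>The three families\<close>

lemma mrange_subset_eqs:
  assumes "\<And>p q \<beta> r. (p, q, \<beta>) \<in> E \<Longrightarrow> A $ p $ r = of_real \<beta> * A $ q $ r"
  shows "mrange A \<subseteq> eqs E"
  using assms
  by (fastforce simp: mrange_def eqs_def matrix_vector_mult_def sum_distrib_left mult.assoc
      intro!: sum.cong)

lemma sum_UNIV_9: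
  fixes f :: "3 \<times> 3 \<Rightarrow> 'a::comm_monoid_add"
  shows "sum f UNIV = f (1,1) + f (1,2) + f (1,3) + f (2,1) + f (2,2) + f (2,3)
     + f (3,1) + f (3,2) + f (3,3)"
proof -
  have "sum f UNIV = (\<Sum>i\<in>UNIV. \<Sum>j\<in>UNIV. f (i, j))"
    by (simp add: sum.cartesian_product UNIV_Times_UNIV)
  then show ?thesis by (simp add: sum_3 add.assoc)
qed

text \<open>Addition in the type \<open>3\<close> is modulo 3, so \<open>k = i + 1\<close> selects
  the cyclic positions (1,2), (2,3), (3,1).\<close>

lemma Amat_nth:
  "Amat a b c $ (i, k) $ (j, l) =
     (if i = j \<and> k = l then of_real (if i = k then a else if k = i + 1 then c else b)
      else if i = k \<and> j = l then 1 else 0)"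
  using exhaust_3[of i] exhaust_3[of k]
  by (elim disjE) (auto simp: Amat_def)

text \<open>The partial transpose of \<open>Amat a b c\<close> has 2 by 2 blocks with diagonal c, b
  and off-diagonal entries 1. For c = 1/b each has rank one, with range spanned by (1, b).\<close>

definition pt_eqs :: "real \<Rightarrow> ((3 \<times> 3) \<times> (3 \<times> 3) \<times> real) set" where
  "pt_eqs b = {((2,1), (1,2), b), ((3,2), (2,3), b), ((1,3), (3,1), b)}"

text \<open>For a = 1 the block of \<open>Amat\<close> on (1,1), (2,2), (3,3) is the all-ones
  matrix, whose range consists of the constant vectors.\<close>

definition diag_eqs :: "((3 \<times> 3) \<times> (3 \<times> 3) \<times> real) set" where
  "diag_eqs = {((1,1), (2,2), 1), ((2,2), (3,3), 1)}"

lemma mrange_Amat_gt_1: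
  assumes "a > 1" "b > 0" "c > 0"
  shows "mrange (Amat a b c) = eqs {}"
proof -
  have "w \<in> mrange (Amat a b c)" for w
  proof -
    \<comment> \<open>The block on (1,1), (2,2), (3,3) is (a - 1) I + J with J all ones;
      \<open>s\<close> is the sum of the three coordinates of the solution, found by adding the
      three equations.\<close>
    define s where "s = (w $ (1,1) + w $ (2,2) + w $ (3,3)) / of_real (a + 2)"
    define k where "k = 1 / complex_of_real (a - 1)"
    define v :: "complex ^ (3 \<times> 3)" where "v = (\<chi> p.
      if fst p = snd p then k * (w $ p - s)
      else if snd p = fst p + 1 then w $ p / of_real c else w $ p / of_real b)"
    have "complex_of_real (a + 2) \<noteq> 0" "complex_of_real (a - 1) \<noteq> 0"
      unfolding of_real_eq_0_iff using assms by auto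
    then have s: "s * (of_real a + 2) = w $ (1,1) + w $ (2,2) + w $ (3,3)"
      and k: "k * (of_real a - 1) = 1"
      by (simp_all add: s_def k_def)
    have "of_real a * (k * (w $ (1,1) - s)) + k * (w $ (2,2) - s) + k * (w $ (3,3) - s) = w $ (1,1)"
      "k * (w $ (1,1) - s) + of_real a * (k * (w $ (2,2) - s)) + k * (w $ (3,3) - s) = w $ (2,2)"
      "k * (w $ (1,1) - s) + k * (w $ (2,2) - s) + of_real a * (k * (w $ (3,3) - s)) = w $ (3,3)"
      using s k by algebra+
    then have "Amat a b c *v v = w"
      unfolding vec_eq_iff split_paired_All forall_3
      using assms by (simp add: matrix_vector_mult_def sum_UNIV_9 Amat_nth v_def)
    then show ?thesis by (auto simp: mrange_def)
  qed
  then show ?thesis by (auto simp: eqs_def)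
qed

lemma mrange_Amat_1:
  assumes "b > 0" "c > 0"
  shows "mrange (Amat 1 b c) = eqs diag_eqs"
proof
  show "mrange (Amat 1 b c) \<subseteq> eqs diag_eqs"
    by (rule mrange_subset_eqs) (auto simp: diag_eqs_def Amat_nth)
  show "eqs diag_eqs \<subseteq> mrange (Amat 1 b c)"
  proof
    fix w assume w: "w \<in> eqs diag_eqs"
    \<comment> \<open>On the rank one block, where \<open>w\<close> is constant, the whole preimage
      is put at (1,1).\<close>
    define v :: "complex ^ (3 \<times> 3)" where "v = (\<chi> p.
      if fst p = snd p then (if fst p = 1 then w $ (1,1) else 0)
      else if snd p = fst p + 1 then w $ p / of_real c else w $ p / of_real b)"
    have "Amat 1 b c *v v = w"
      unfolding vec_eq_iff split_paired_All forall_3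
      using assms w
      by (simp add: matrix_vector_mult_def sum_UNIV_9 Amat_nth v_def eqs_def diag_eqs_def)
    then show "w \<in> mrange (Amat 1 b c)" by (auto simp: mrange_def)
  qed
qed

lemma mrange_pt_Amat_rank_deficient:
  assumes "a > 0" "b > 0"
  shows "mrange (partial_transpose (Amat a b (1 / b))) = eqs (pt_eqs b)"
proof
  show "mrange (partial_transpose (Amat a b (1 / b))) \<subseteq> eqs (pt_eqs b)"
    using assms
    by (intro mrange_subset_eqs) (auto simp: pt_eqs_def Amat_nth partial_transpose_nth)
  show "eqs (pt_eqs b) \<subseteq> mrange (partial_transpose (Amat a b (1 / b)))"
  proof
    fix w assume w: "w \<in> eqs (pt_eqs b)"
    \<comment> \<open>In each singular 2 by 2 block the preimage is put at the index (i, i + 1),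
      where the diagonal entry is 1/b.\<close>
    define v :: "complex ^ (3 \<times> 3)" where "v = (\<chi> p.
      if fst p = snd p then w $ p / of_real a
      else if snd p = fst p + 1 then of_real b * w $ p else 0)"
    have "partial_transpose (Amat a b (1 / b)) *v v = w"
      unfolding vec_eq_iff split_paired_All forall_3
      using assms w
      by (simp add: matrix_vector_mult_def sum_UNIV_9 Amat_nth partial_transpose_nth v_def
          eqs_def pt_eqs_def)
    then show "w \<in> mrange (partial_transpose (Amat a b (1 / b)))" by (auto simp: mrange_def)
  qed
qed

lemma mrange_pt_Amat_full_rank:
  assumes "a > 0" "b * c > 1"
  shows "mrange (partial_transpose (Amat a b c)) = eqs {}"
proof -
  have "w \<in> mrange (partial_transpose (Amat a b c))" for w
  proof -
    \<comment> \<open>Reciprocal of the determinant of each 2 by 2 block; \<open>v\<close> is then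
      given by Cramer's rule.\<close>
    define k where "k = 1 / complex_of_real (b * c - 1)"
    define v :: "complex ^ (3 \<times> 3)" where "v = (\<chi> p.
      if fst p = snd p then w $ p / of_real a
      else if snd p = fst p + 1 then k * (of_real b * w $ p - w $ prod.swap p)
      else k * (of_real c * w $ p - w $ prod.swap p))"
    have "complex_of_real (b * c - 1) \<noteq> 0"
      unfolding of_real_eq_0_iff using assms by auto
    then have k: "k * (of_real b * of_real c - 1) = 1"
      by (simp add: k_def)
    have "of_real c * (k * (of_real b * z - z')) + k * (of_real c * z' - z) = z"
      "k * (of_real b * z - z') + of_real b * (k * (of_real c * z' - z)) = z'"
      "of_real b * (k * (of_real c * z - z')) + k * (of_real b * z' - z) = z"
      "k * (of_real c * z - z') + of_real c * (k * (of_real b * z' - z)) = z'" for z z'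
      using k by algebra+
    then have "partial_transpose (Amat a b c) *v v = w"
      unfolding vec_eq_iff split_paired_All forall_3
      using assms by (simp add: matrix_vector_mult_def sum_UNIV_9 Amat_nth partial_transpose_nth v_def)
    then show ?thesis by (auto simp: mrange_def)
  qed
  then show ?thesis by (auto simp: eqs_def)
qed

text \<open>\<Phi>(1) is the reduction map, sending X to Tr(X) I - X.\<close>

lemma Phi1_nth: "Phi1 X $ k $ l = (if k = l then trace X - X $ k $ k else - X $ k $ l)"
  using exhaust_3[of k] exhaust_3[of l]
  by (elim disjE) (simp_all add: Phi1_def trace_def sum_3)

lemma Choi_Phi1_nth:
  "Choi Phi1 $ (i, k) $ (j, l) =
     (if i = j \<and> k = l then (if i = k then 0 else 1)
      else if i = k \<and> j = l then - 1 else 0)"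
proof -
  have "Choi Phi1 $ (i, k) $ (j, l) = Phi1 (munit i j) $ k $ l"
    using kron_munit_sum_nth[of "\<lambda>i j. Phi1 (munit i j)" i k j l] by (simp only: Choi_def)
  moreover have "trace (munit i j) = (if i = j then 1 else 0)"
    by (auto simp: trace_def munit_def intro!: sum.neutral)
  moreover have "munit i j $ k $ l = (if k = i \<and> l = j then 1 else 0)" for k l
    by (simp add: munit_def)
  ultimately show ?thesis
    by (auto simp: Phi1_nth)
qed

text \<open>The entry of \<open>B\<close> at (i,i), (j,j) is the entry of its partial transpose at
  (j,i), (i,j), so the pairing splits into three quadratic forms at differences of basis
  vectors.\<close>

lemma pairing_Phi1:
  "pairing B Phi1 = defect {} B + defect (pt_eqs 1) (partial_transpose B)"
  by (simp add: pairing_def trace_def matrix_matrix_mult_def transpose_def sum_UNIV_9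
      Choi_Phi1_nth defect_def pt_eqs_def partial_transpose_nth)

section \<open>Subtracting small multiples of product vectors\<close>

text \<open>It remains to find a separable \<open>X\<close> that agrees with the twirled difference
  off the diagonal and does not exceed it on the diagonal.\<close>

lemma absorb_outer_Amat:
  fixes a b c :: real
  defines "d \<equiv> \<lambda>i k :: 3. if i = k then a else if k = i + 1 then c else b"
  assumes X: "X \<in> V1" and \<epsilon>: "\<epsilon> > 0"
    and off: "\<And>i j. i \<noteq> j \<Longrightarrow> X $ (i, i) $ (j, j) = 1 - of_real \<epsilon> * (x $ i * y $ i * cnj (x $ j * y $ j))"
    and off0: "\<And>i j k l. (i, j) \<noteq> (k, l) \<Longrightarrow> i \<noteq> j \<or> k \<noteq> l \<Longrightarrow> X $ (i, j) $ (k, l) = 0"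
    and diag: "\<And>i j. X $ (i, j) $ (i, j) = of_real (D i j)"
    and D: "\<And>i j. D i j + \<epsilon> * ((cmod (x $ i))\<^sup>2 * (cmod (y $ j))\<^sup>2) \<le> d i j"
  shows "\<exists>\<epsilon>>0. Amat a b c - \<epsilon> *\<^sub>R outer (prod_vec x y) \<in> V1"
proof (rule absorb_outer_if_absorb_twirl[OF \<epsilon>], rule V1_add_diagonal[OF X])
  show "(Amat a b c - \<epsilon> *\<^sub>R twirl x y) $ p $ q = X $ p $ q" if "p \<noteq> q" for p q
    using that off off0
    by (cases p; cases q) (auto simp: Amat_nth twirl_def scaleR_conv_of_real[where 'a = complex])
  show "\<exists>e\<ge>0. (Amat a b c - \<epsilon> *\<^sub>R twirl x y) $ p $ p = X $ p $ p + of_real e" for p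
  proof (cases p)
    case (Pair i j)
    have "(Amat a b c - \<epsilon> *\<^sub>R twirl x y) $ p $ p
      = X $ p $ p + of_real (d i j - D i j - \<epsilon> * ((cmod (x $ i))\<^sup>2 * (cmod (y $ j))\<^sup>2))"
      by (simp add: Pair Amat_nth twirl_def scaleR_conv_of_real[where 'a = complex] diag d_def)
    then show ?thesis using D[of i j] by (metis diff_diff_eq diff_ge_0_iff_ge)
  qed
qed

lemma twirl_nth:
  "twirl x y $ (i, k) $ (j, l) =
     (if i = j \<and> k = l then of_real ((cmod (x $ i))\<^sup>2 * (cmod (y $ k))\<^sup>2)
     else if i = k \<and> j = l then x $ i * y $ i * cnj (x $ j * y $ j) else 0)"
  by (simp add: twirl_def)

lemma ex_small:
  fixes S \<delta> :: real
  assumes "S \<ge> 0" "\<delta> > 0"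
  obtains \<epsilon> where "\<epsilon> > 0" "\<And>s. s \<le> S \<Longrightarrow> \<epsilon> * s \<le> \<delta>"
proof
  show "\<delta> / (1 + S) > 0" using assms by simp
  show "\<delta> / (1 + S) * s \<le> \<delta>" if "s \<le> S" for s
    using that assms mult_left_mono[of s "1 + S" \<delta>] by (simp add: pos_divide_le_eq)
qed

lemma prod_coord_le_norms:
  "(cmod (x $ i))\<^sup>2 * (cmod (y $ j))\<^sup>2 \<le> (norm x)\<^sup>2 * (norm y)\<^sup>2"
  by (intro mult_mono power_mono Finite_Cartesian_Product.norm_nth_le) auto

text \<open>All x_i y_i coincide, so off the diagonal the difference is a multiple of the twirl of
  the all-ones vectors. The entries at (i,i) match exactly; elsewhere on the diagonal b - 1 and c -
  1 leave room.\<close>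

lemma absorb_outer_diag_eqs:
  fixes b c :: real
  assumes "b > 1" "c > 1" and xy: "prod_vec x y \<in> eqs diag_eqs"
  shows "\<exists>\<epsilon>>0. Amat 1 b c - \<epsilon> *\<^sub>R outer (prod_vec x y) \<in> V1"
proof -
  define \<kappa> where "\<kappa> = x $ 1 * y $ 1"
  have \<kappa>: "x $ i * y $ i = \<kappa>" for i
    using xy exhaust_3[of i] by (auto simp: \<kappa>_def eqs_def diag_eqs_def prod_vec_def)
  obtain \<epsilon> where \<epsilon>: "\<epsilon> > 0" and "\<And>s. s \<le> (norm x)\<^sup>2 * (norm y)\<^sup>2 \<Longrightarrow> \<epsilon> * s \<le> min 1 (min (b - 1) (c - 1))"
    using assms by (elim ex_small[of "(norm x)\<^sup>2 * (norm y)\<^sup>2" "min 1 (min (b - 1) (c - 1))", rotated 2]) auto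
  then have le: "\<epsilon> * ((cmod (x $ i))\<^sup>2 * (cmod (y $ j))\<^sup>2) \<le> min 1 (min (b - 1) (c - 1))" for i j
    using prod_coord_le_norms by blast
  define K where "K = (cmod \<kappa>)\<^sup>2"
  have K: "(cmod (x $ i))\<^sup>2 * (cmod (y $ i))\<^sup>2 = K" for i
    using \<kappa>[of i] by (metis K_def norm_mult power_mult_distrib)
  then have "\<epsilon> * K \<le> 1" "\<epsilon> * K \<ge> 0" using le[of 1 1] \<epsilon> by (auto simp: K_def)
  let ?X = "(1 - \<epsilon> * K) *\<^sub>R twirl (\<chi> i. 1) (\<chi> i. 1)"
  show ?thesis
  proof (rule absorb_outer_Amat[OF _ \<epsilon>, where X = ?X and D = "\<lambda>i j. 1 - \<epsilon> * K"])
    show "?X \<in> V1" using \<open>\<epsilon> * K \<le> 1\<close> by (intro V1_scaleR twirl_in_V1) simp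
    show "?X $ (i, i) $ (j, j) = 1 - of_real \<epsilon> * (x $ i * y $ i * cnj (x $ j * y $ j))"
      if "i \<noteq> j" for i j
      using that by (simp only: \<kappa> flip: complex_norm_square)
        (simp add: twirl_nth K_def scaleR_conv_of_real[where 'a = complex])
    show "1 - \<epsilon> * K + \<epsilon> * ((cmod (x $ i))\<^sup>2 * (cmod (y $ j))\<^sup>2)
        \<le> (if i = j then 1 else if j = i + 1 then c else b)" for i j
      using le[of i j] K[of i] \<open>\<epsilon> * K \<ge> 0\<close> by auto
  qed (auto simp: twirl_nth scaleR_conv_of_real[where 'a = complex])
qed

text \<open>Multiplying the equation by \<open>xi\<close> and the conjugate of \<open>yj\<close>
  gives the real off-diagonal entries; its squared modulus relates the two mixed diagonal
  entries.\<close>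

lemma pt_eqs_entries:
  assumes "cnj xj * yi = of_real b * (cnj xi * yj)"
  shows "xi * yi * cnj (xj * yj) = of_real (b * ((cmod xi)\<^sup>2 * (cmod yj)\<^sup>2))"
    and "xj * yj * cnj (xi * yi) = of_real (b * ((cmod xi)\<^sup>2 * (cmod yj)\<^sup>2))"
    and "(cmod xj)\<^sup>2 * (cmod yi)\<^sup>2 = b\<^sup>2 * ((cmod xi)\<^sup>2 * (cmod yj)\<^sup>2)"
proof -
  have "xi * yi * cnj (xj * yj) = xi * (cnj xj * yi) * cnj yj"
    by simp
  also have "\<dots> = of_real (b * ((cmod xi)\<^sup>2 * (cmod yj)\<^sup>2))"
    unfolding assms of_real_mult complex_norm_square by (simp add: mult_ac)
  finally show 1: "xi * yi * cnj (xj * yj) = of_real (b * ((cmod xi)\<^sup>2 * (cmod yj)\<^sup>2))" .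
  show "xj * yj * cnj (xi * yi) = of_real (b * ((cmod xi)\<^sup>2 * (cmod yj)\<^sup>2))"
    using arg_cong[OF 1, of cnj] by (simp add: mult_ac)
  have "(cmod (cnj xj * yi))\<^sup>2 = (cmod (of_real b * (cnj xi * yj)))\<^sup>2"
    using assms by simp
  then show "(cmod xj)\<^sup>2 * (cmod yi)\<^sup>2 = b\<^sup>2 * ((cmod xi)\<^sup>2 * (cmod yj)\<^sup>2)"
    by (simp add: norm_mult power_mult_distrib)
qed

text \<open>Three twirls, one for each cyclic pair of coordinates, produce the off-diagonal entries.
  Each position (i,i) is charged by two of them, at most 2 in total, which is where a > 2
  enters.\<close>

lemma absorb_outer_pt_eqs:
  fixes a b :: real
  assumes "b > 0" "a > 2" and xy: "prod_vec (cnj_vec x) y \<in> eqs (pt_eqs b)"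
  shows "\<exists>\<epsilon>>0. Amat a b (1 / b) - \<epsilon> *\<^sub>R outer (prod_vec x y) \<in> V1"
proof -
  define \<kappa> where "\<kappa> i j = (cmod (x $ i))\<^sup>2 * (cmod (y $ j))\<^sup>2" for i j
  have eqs: "cnj (x $ 2) * y $ 1 = of_real b * (cnj (x $ 1) * y $ 2)"
    "cnj (x $ 3) * y $ 2 = of_real b * (cnj (x $ 2) * y $ 3)"
    "cnj (x $ 1) * y $ 3 = of_real b * (cnj (x $ 3) * y $ 1)"
    using xy by (auto simp: eqs_def pt_eqs_def prod_vec_def cnj_vec_def)
  note entries = pt_eqs_entries[OF eqs(1), folded \<kappa>_def] pt_eqs_entries[OF eqs(2), folded \<kappa>_def]
    pt_eqs_entries[OF eqs(3), folded \<kappa>_def]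
  \<comment> \<open>The bound 1/b keeps the weights \<open>m\<close> nonnegative; a - 2 is the room
    left at the positions (i,i).\<close>
  obtain \<epsilon> where \<epsilon>: "\<epsilon> > 0" and "\<And>s. s \<le> (norm x)\<^sup>2 * (norm y)\<^sup>2 \<Longrightarrow> \<epsilon> * s \<le> min (1 / b) (a - 2)"
    using assms by (elim ex_small[of "(norm x)\<^sup>2 * (norm y)\<^sup>2" "min (1 / b) (a - 2)", rotated 2]) auto
  then have le: "\<epsilon> * \<kappa> i j \<le> min (1 / b) (a - 2)" for i j
    using prod_coord_le_norms unfolding \<kappa>_def by blast
  define m where "m i j = 1 - \<epsilon> * (b * \<kappa> i j)" for i j
  have m: "0 \<le> m i j" "m i j \<le> 1" for i j
    using le[of i j] assms \<epsilon> by (auto simp: m_def \<kappa>_def field_simps)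
  \<comment> \<open>The factors \<open>sqrt b\<close> and \<open>1 / sqrt b\<close> cancel in the
    off-diagonal entries, while the diagonal gets 1/b at (i, i + 1) and b at (i + 1, i), in the
    proportion prescribed by \<open>Amat\<close>.\<close>
  define U where "U i = twirl (\<chi> k. if k = i then 1 else if k = i + 1 then of_real (sqrt b) else 0)
      (\<chi> k. if k = i then 1 else if k = i + 1 then of_real (1 / sqrt b) else 0)" for i :: 3
  define X where "X = m 1 2 *\<^sub>R U 1 + m 2 3 *\<^sub>R U 2 + m 3 1 *\<^sub>R U 3"
  define d where "d l i j = (if i = l then 1 else if i = l + 1 then b else 0)
      * (if j = l then 1 else if j = l + 1 then 1 / b else 0)" for l i j :: 3
  define D where "D i j = m 1 2 * d 1 i j + m 2 3 * d 2 i j + m 3 1 * d 3 i j" for i j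
  have U: "U l $ (i, j) $ (i', j') =
     (if i = i' \<and> j = j' then of_real (d l i j)
      else if i = j \<and> i' = j' then
        (if i = l \<or> i = l + 1 then 1 else 0) * (if i' = l \<or> i' = l + 1 then 1 else 0)
      else 0)" for l i j i' j'
  proof -
    have "(cmod (if k = l then 1 else if k = l + 1 then of_real (sqrt b) else 0))\<^sup>2
        = (if k = l then 1 else if k = l + 1 then b else 0)"
      "(cmod (if k = l then 1 else if k = l + 1 then of_real (1 / sqrt b) else 0))\<^sup>2
        = (if k = l then 1 else if k = l + 1 then 1 / b else 0)"
      "(if k = l then 1 else if k = l + 1 then complex_of_real (sqrt b) else 0)
        * (if k = l then 1 else if k = l + 1 then complex_of_real (1 / sqrt b) else 0)
        = (if k = l \<or> k = l + 1 then 1 else 0)" for k :: 3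
      using \<open>b > 0\<close> by (simp_all add: norm_divide power_divide)
    then show ?thesis
      unfolding U_def twirl_nth vec_lambda_beta d_def
      by (simp only: if_distrib[of cnj] complex_cnj_one complex_cnj_zero)
  qed
  show ?thesis
  proof (rule absorb_outer_Amat[OF _ \<epsilon>, where X = X and D = D])
    show "X \<in> V1" unfolding X_def U_def using m by (intro V1_scaleR V1_add twirl_in_V1)
    have "\<forall>i j. i \<noteq> j \<longrightarrow> X $ (i, i) $ (j, j) = 1 - of_real \<epsilon> * (x $ i * y $ i * cnj (x $ j * y $ j))"
      unfolding forall_3 entries
      by (simp add: X_def U m_def scaleR_conv_of_real[where 'a = complex])
    then show "X $ (i, i) $ (j, j) = 1 - of_real \<epsilon> * (x $ i * y $ i * cnj (x $ j * y $ j))"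
      if "i \<noteq> j" for i j using that by blast
    show "X $ (i, j) $ (k, l) = 0" if "(i, j) \<noteq> (k, l)" "i \<noteq> j \<or> k \<noteq> l" for i j k l
      using that by (auto simp: X_def U)
    show "X $ (i, j) $ (i, j) = of_real (D i j)" for i j
      by (simp add: X_def U D_def scaleR_conv_of_real[where 'a = complex])
    have "\<forall>i j. D i j + \<epsilon> * \<kappa> i j \<le> (if i = j then a else if j = i + 1 then 1 / b else b)"
      unfolding forall_3 using entries(3,6,9) \<open>b > 0\<close> m[of 1 2] m[of 2 3] m[of 3 1]
        le[of 1 1] le[of 2 2] le[of 3 3]
      by (simp add: D_def d_def) (simp add: m_def field_simps power2_eq_square)
    then show "D i j + \<epsilon> * ((cmod (x $ i))\<^sup>2 * (cmod (y $ j))\<^sup>2)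
        \<le> (if i = j then a else if j = i + 1 then 1 / b else b)" for i j
      unfolding \<kappa>_def by blast
  qed
qed

lemma eventually_quotient_lt:
  fixes p q r s a :: real
  assumes "a > 1"
  shows "\<forall>\<^sub>F \<epsilon> in at_right 0. (1 - \<epsilon> * p) * (1 - \<epsilon> * q) / (1 - \<epsilon> * r) + \<epsilon> * s < a"
proof (rule order_tendstoD)
  show "((\<lambda>\<epsilon>. (1 - \<epsilon> * p) * (1 - \<epsilon> * q) / (1 - \<epsilon> * r) + \<epsilon> * s) \<longlongrightarrow> 1) (at_right 0)"
    by (auto intro!: tendsto_eq_intros)
qed (rule assms)

lemma eventually_pos:
  fixes p :: real
  shows "\<forall>\<^sub>F \<epsilon> in at_right 0. 0 < 1 - \<epsilon> * p"
proof (rule order_tendstoD)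
  show "((\<lambda>\<epsilon>. 1 - \<epsilon> * p) \<longlongrightarrow> 1) (at_right 0)"
    by (auto intro!: tendsto_eq_intros)
qed simp

text \<open>
  The off-diagonal entries \<open>m12, m23, m31\<close> of the difference are those of the rank one matrix
  \<open>u u\<^sup>t\<close> with \<open>u_1\<^sup>2 = m12 m31 / m23\<close> and so on; as \<open>\<epsilon>\<close> tends to 0, \<open>u_i\<^sup>2\<close> tends to \<open>1 < a\<close>.
\<close>

lemma absorb_outer_pt_eqs_1:
  fixes a :: real
  assumes "a > 1" and xy: "prod_vec (cnj_vec x) y \<in> eqs (pt_eqs 1)"
  shows "\<exists>\<epsilon>>0. Amat a 1 1 - \<epsilon> *\<^sub>R outer (prod_vec x y) \<in> V1"
proof -
  define \<kappa> where "\<kappa> i j = (cmod (x $ i))\<^sup>2 * (cmod (y $ j))\<^sup>2" for i j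
  have eqs: "cnj (x $ 2) * y $ 1 = of_real 1 * (cnj (x $ 1) * y $ 2)"
    "cnj (x $ 3) * y $ 2 = of_real 1 * (cnj (x $ 2) * y $ 3)"
    "cnj (x $ 1) * y $ 3 = of_real 1 * (cnj (x $ 3) * y $ 1)"
    using xy by (auto simp: eqs_def pt_eqs_def prod_vec_def cnj_vec_def)
  note entries = pt_eqs_entries[OF eqs(1), folded \<kappa>_def] pt_eqs_entries[OF eqs(2), folded \<kappa>_def]
    pt_eqs_entries[OF eqs(3), folded \<kappa>_def]
  define m where "m \<epsilon> i j = 1 - \<epsilon> * \<kappa> i j" for \<epsilon> i j
  \<comment> \<open>Finitely many conditions, each valid for all small positive
    \<open>\<epsilon>\<close>, hold for a common one.\<close>
  have "\<forall>\<^sub>F \<epsilon> in at_right 0. \<epsilon> > 0 \<and> m \<epsilon> 1 2 > 0 \<and> m \<epsilon> 2 3 > 0 \<and> m \<epsilon> 3 1 > 0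
    \<and> m \<epsilon> 1 2 * m \<epsilon> 3 1 / m \<epsilon> 2 3 + \<epsilon> * \<kappa> 1 1 < a
    \<and> m \<epsilon> 1 2 * m \<epsilon> 2 3 / m \<epsilon> 3 1 + \<epsilon> * \<kappa> 2 2 < a
    \<and> m \<epsilon> 2 3 * m \<epsilon> 3 1 / m \<epsilon> 1 2 + \<epsilon> * \<kappa> 3 3 < a"
    unfolding m_def using assms(1)
    by (intro eventually_conj eventually_quotient_lt eventually_pos eventually_at_right_less)
  then obtain \<epsilon> where \<epsilon>: "\<epsilon> > 0" and pos: "m \<epsilon> 1 2 > 0" "m \<epsilon> 2 3 > 0" "m \<epsilon> 3 1 > 0"
    and lt: "m \<epsilon> 1 2 * m \<epsilon> 3 1 / m \<epsilon> 2 3 + \<epsilon> * \<kappa> 1 1 < a"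
    "m \<epsilon> 1 2 * m \<epsilon> 2 3 / m \<epsilon> 3 1 + \<epsilon> * \<kappa> 2 2 < a"
    "m \<epsilon> 2 3 * m \<epsilon> 3 1 / m \<epsilon> 1 2 + \<epsilon> * \<kappa> 3 3 < a"
    using eventually_happens[of _ "at_right (0::real)"] by (auto simp: trivial_limit_at_right_real)
  define u :: "real ^ 3" where "u = vector [sqrt (m \<epsilon> 1 2 * m \<epsilon> 3 1 / m \<epsilon> 2 3),
    sqrt (m \<epsilon> 1 2 * m \<epsilon> 2 3 / m \<epsilon> 3 1), sqrt (m \<epsilon> 2 3 * m \<epsilon> 3 1 / m \<epsilon> 1 2)]"
  have u_nonneg: "u $ i \<ge> 0" for i
    using pos exhaust_3[of i] by (auto simp: u_def)
  have u_sq: "u $ 1 * u $ 1 = m \<epsilon> 1 2 * m \<epsilon> 3 1 / m \<epsilon> 2 3" "u $ 2 * u $ 2 = m \<epsilon> 1 2 * m \<epsilon> 2 3 / m \<epsilon> 3 1"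
    "u $ 3 * u $ 3 = m \<epsilon> 2 3 * m \<epsilon> 3 1 / m \<epsilon> 1 2"
    using pos by (simp_all add: u_def)
  have u_off: "u $ 1 * u $ 2 = m \<epsilon> 1 2" "u $ 2 * u $ 3 = m \<epsilon> 2 3" "u $ 3 * u $ 1 = m \<epsilon> 3 1"
    using pos by (simp_all add: u_def real_sqrt_unique power2_eq_square flip: real_sqrt_mult)
  \<comment> \<open>With both factors equal to the root of \<open>u\<close>, the twirl has u_i u_j
    at the off-diagonal pattern positions and also at the diagonal position (i,j).\<close>
  let ?v = "(\<chi> i. complex_of_real (sqrt (u $ i))) :: complex ^ 3"
  have sq: "complex_of_real (sqrt (u $ i)) * complex_of_real (sqrt (u $ i)) = of_real (u $ i)" for i
    using u_nonneg[of i] by (simp flip: of_real_mult)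
  show ?thesis
  proof (rule absorb_outer_Amat[OF twirl_in_V1 \<epsilon>, where x1 = ?v and y1 = ?v and D = "\<lambda>i j. u $ i * u $ j"])
    have "\<forall>i j. i \<noteq> j \<longrightarrow> of_real (u $ i * u $ j) = 1 - of_real \<epsilon> * (x $ i * y $ i * cnj (x $ j * y $ j))"
      unfolding forall_3 entries using u_off by (simp add: m_def mult.commute)
    then show "twirl ?v ?v $ (i, i) $ (j, j) = 1 - of_real \<epsilon> * (x $ i * y $ i * cnj (x $ j * y $ j))"
      if "i \<noteq> j" for i j using that by (simp add: twirl_nth sq)
    show "twirl ?v ?v $ (i, j) $ (i, j) = of_real (u $ i * u $ j)" for i j
      using u_nonneg by (simp add: twirl_nth)
    have "\<forall>i j. u $ i * u $ j + \<epsilon> * \<kappa> i j \<le> (if i = j then a else if j = i + 1 then 1 else 1)"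
      unfolding forall_3 using entries(3,6,9) u_off u_sq lt
      by (simp add: mult.commute m_def)
    then show "u $ i * u $ j + \<epsilon> * ((cmod (x $ i))\<^sup>2 * (cmod (y $ j))\<^sup>2)
        \<le> (if i = j then a else if j = i + 1 then 1 else 1)" for i j
      unfolding \<kappa>_def by blast
  qed (auto simp: twirl_nth)
qed

lemma finite_pt_eqs: "finite (pt_eqs b)" and finite_diag_eqs: "finite diag_eqs"
  by (simp_all add: pt_eqs_def diag_eqs_def)

theorem theorem5p1:
  shows "(\<forall>a::real. a > 1 \<longrightarrow>
            V1_face (Amat a 1 1) = V1 \<inter> PPT_face (Amat a 1 1) \<and>
            V1 \<inter> PPT_face (Amat a 1 1) = dual_face Phi1) \<and>
         (\<forall>a b::real. b > 0 \<and> b \<noteq> 1 \<and> a > 2 \<longrightarrow>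
            V1_face (Amat a b (1 / b)) = V1 \<inter> PPT_face (Amat a b (1 / b))) \<and>
         (\<forall>b c::real. b > 1 \<and> c > 1 \<longrightarrow>
            V1_face (Amat 1 b c) = V1 \<inter> PPT_face (Amat 1 b c))"
proof (intro conjI allI impI; (elim conjE)?)
  fix a :: real assume "a > 1"
  then have "mrange (Amat a 1 1) = eqs {}"
      "mrange (partial_transpose (Amat a 1 1)) = eqs (pt_eqs 1)"
    using mrange_Amat_gt_1 mrange_pt_Amat_rank_deficient[of a 1] by auto
  \<comment> \<open>\<open>Amat a 1 1\<close> has full rank, so only the partial transpose imposes
    equations, and the total defect is the pairing with \<Phi>(1).\<close>
  note * = V1_face_eq_defect[OF _ finite_pt_eqs this absorb_outer_pt_eqs_1[OF \<open>a > 1\<close>]]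
  show "V1_face (Amat a 1 1) = V1 \<inter> PPT_face (Amat a 1 1)"
    by (rule *) auto
  show "V1 \<inter> PPT_face (Amat a 1 1) = dual_face Phi1"
    unfolding dual_face_def pairing_Phi1 by (rule *) auto
next
  fix a b :: real assume b: "b > 0" "a > 2"
  show "V1_face (Amat a b (1 / b)) = V1 \<inter> PPT_face (Amat a b (1 / b))"
    by (rule V1_face_eq_defect[OF _ finite_pt_eqs mrange_Amat_gt_1 mrange_pt_Amat_rank_deficient absorb_outer_pt_eqs])
      (use b in auto)
next
  fix b c :: real assume bc: "b > 1" "c > 1"
  then have "b * c > 1" using less_1_mult by blast
  \<comment> \<open>The roles are exchanged: the partial transpose has full rank because bc > 1, and
    the equations come from \<open>Amat 1 b c\<close>.\<close>
  show "V1_face (Amat 1 b c) = V1 \<inter> PPT_face (Amat 1 b c)"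
    by (rule V1_face_eq_defect[OF finite_diag_eqs _ mrange_Amat_1 mrange_pt_Amat_full_rank absorb_outer_diag_eqs])
      (use bc \<open>b * c > 1\<close> in auto)
qed

end
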